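(* Let $(M,g)$ be the Robinson–Trautman spacetime with coordinates $(t,r,x,y)$, constants $a,b,d\in\mathbb R$ and function $f=f(x,y)$, and let $F_1=f_x^2+f_y^2-f(f_{xx}+f_{yy})$. If $b=d=0$, $F_1-2a\neq0$ and $rF_1-2ar\neq0$ on $M$, then the spacetime admits curvature inheritance with respect to $\xi=\frac{\partial}{\partial x}$, given by $$\mathscr L_\xi R=\frac{8af_x-4f_y^2f_x+3ff_{yy}f_x-4f_x^3+2ff_yf_{xy}-f^2f_{xyy}+5ff_xf_{xx}-f^2f_{xxx}}{f(F_1-2a)}\,R.$$
   Context: Robinson–Trautman (RT) spacetime: $a,b,d\in\mathbb R$ are constants; $M=I\times J\times\Omega$ with coordinates $(x^1,x^2,x^3,x^4)=(t,r,x,y)$, where $I\subset\mathbb R$ and $J\subset\mathbb R\setminus\{0\}$ are open intervals and $\Omega\subset\mathbb R^2$ is open, connected and nonempty; $f:\Omega\to\mathbb R$ is smooth and nowhere vanishing, with subscripts denoting partial derivatives; the metric is $$g=-2\Big(a-2br-\frac dr\Big)dt^2+2\,dt\,dr-\frac{r^2}{f^2}(dx^2+dy^2).$$ ($2\,dt\,dr$ means $g_{12}=g_{21}=1$.) Curvature convention: with $\Gamma$ the Levi-Civita connection coefficients, $R_{pqrs}=g_{p\alpha}(\partial_r\Gamma^\alpha_{qs}-\partial_s\Gamma^\alpha_{qr}+\Gamma^\beta_{qs}\Gamma^\alpha_{\beta r}-\Gamma^\beta_{qr}\Gamma^\alpha_{\beta s})$ (type $(0,4)$ Riemann tensor). Curvature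 inheritance with respect to $\xi$ means $\mathscr L_\xi R=\lambda R$ for a smooth function $\lambda$, where $\mathscr L_\xi$ is the Lie derivative of the $(0,4)$ tensor. *)

theory Defs
  imports "HOL-Analysis.Analysis"
begin

section \<open>Partial derivatives and smoothness\<close>

definition pd :: "'n::finite \<Rightarrow> (real^'n \<Rightarrow> real) \<Rightarrow> real^'n \<Rightarrow> real" where
  "pd i h p = deriv (\<lambda>s. h (p + s *\<^sub>R axis i 1)) 0"

text \<open>To be used on open sets \<open>S\<close> only; there, the values of \<open>h\<close> outside \<open>S\<close> are irrelevant.\<close>

primrec Ck_on :: "nat \<Rightarrow> (real^'n::finite) set \<Rightarrow> (real^'n \<Rightarrow> real) \<Rightarrow> bool" where
  "Ck_on 0 S h \<longleftrightarrow> continuous_on S h"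
| "Ck_on (Suc k) S h \<longleftrightarrow> (\<forall>p\<in>S. h differentiable (at p)) \<and> (\<forall>i. Ck_on k S (pd i h))"

definition smooth_on :: "(real^'n::finite) set \<Rightarrow> (real^'n \<Rightarrow> real) \<Rightarrow> bool" where
  "smooth_on S h \<longleftrightarrow> (\<forall>k. Ck_on k S h)"

section \<open>Curvature and Lie derivative in a coordinate chart\<close>

text \<open>Everything lives on an open subset of \<open>\<real>\<^sup>n\<close>, with the standard coordinates. Tensor fields of
  type \<open>(0,4)\<close> are given by their components, as functions of the point.\<close>

type_synonym 'n metric_field = "real^'n \<Rightarrow> real^'n^'n"
type_synonym 'n vector_field = "real^'n \<Rightarrow> real^'n"
type_synonym 'n tensor04 = "'n \<Rightarrow> 'n \<Rightarrow> 'n \<Rightarrow> 'n \<Rightarrow> real^'n \<Rightarrow> real"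

text \<open>\<open>christoffel g a b c\<close> is the coefficient with upper index \<open>a\<close> and lower indices \<open>b, c\<close> of the
  Levi-Civita connection of \<open>g\<close>.\<close>

definition christoffel ::
  "('n::finite) metric_field \<Rightarrow> 'n \<Rightarrow> 'n \<Rightarrow> 'n \<Rightarrow> real^'n \<Rightarrow> real" where
  "christoffel g a b c p =
     (1/2) * (\<Sum>e\<in>UNIV. matrix_inv (g p) $ a $ e *
       (pd b (\<lambda>q. g q $ e $ c) p + pd c (\<lambda>q. g q $ e $ b) p - pd e (\<lambda>q. g q $ b $ c) p))"

definition riemann :: "('n::finite) metric_field \<Rightarrow> 'n tensor04" where
  "riemann g p q r s x =
     (\<Sum>\<alpha>\<in>UNIV. g x $ p $ \<alpha> *
       (pd r (christoffel g \<alpha> q s) x - pd s (christoffel g \<alpha> q r) x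
        + (\<Sum>\<beta>\<in>UNIV. christoffel g \<beta> q s x * christoffel g \<alpha> \<beta> r x)
        - (\<Sum>\<beta>\<in>UNIV. christoffel g \<beta> q r x * christoffel g \<alpha> \<beta> s x)))"

definition lie_derivative :: "('n::finite) vector_field \<Rightarrow> 'n tensor04 \<Rightarrow> 'n tensor04" where
  "lie_derivative \<xi> T p q r s x =
     (\<Sum>e\<in>UNIV. \<xi> x $ e * pd e (T p q r s) x
       + pd p (\<lambda>y. \<xi> y $ e) x * T e q r s x
       + pd q (\<lambda>y. \<xi> y $ e) x * T p e r s x
       + pd r (\<lambda>y. \<xi> y $ e) x * T p q e s x
       + pd s (\<lambda>y. \<xi> y $ e) x * T p q r e x)"

definition curvature_inheritance ::
  "(real^'n::finite) set \<Rightarrow> 'n metric_field \<Rightarrow> 'n vector_field \<Rightarrow> (real^'n \<Rightarrow> real) \<Rightarrow> bool" where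
  "curvature_inheritance M g \<xi> \<phi> \<longleftrightarrow>
     smooth_on M \<phi> \<and>
     (\<forall>x\<in>M. \<forall>p q r s.
        lie_derivative \<xi> (riemann g) p q r s x = \<phi> x * riemann g p q r s x)"

section \<open>Robinson--Trautman spacetime\<close>

text \<open>The coordinates \<open>(t,r,x,y)\<close> are the components \<open>1, 2, 3, 4\<close> of a point of \<open>\<real>\<^sup>4\<close>
  (in the index type \<open>4\<close>, the numeral \<open>4\<close> is the element \<open>0\<close>).\<close>

definition xy :: "real^4 \<Rightarrow> real^2" where
  "xy p = vector [p $ 3, p $ 4]"

definition RT_domain :: "real set \<Rightarrow> real set \<Rightarrow> (real^2) set \<Rightarrow> (real^4) set" where
  "RT_domain I J \<Omega> = {p. p $ 1 \<in> I \<and> p $ 2 \<in> J \<and> xy p \<in> \<Omega>}"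

definition RT_metric :: "real \<Rightarrow> real \<Rightarrow> real \<Rightarrow> (real^2 \<Rightarrow> real) \<Rightarrow> 4 metric_field" where
  "RT_metric a b d f p = (let r = p $ 2; w = - (r^2 / (f (xy p))^2) in
     vector [vector [- 2 * (a - 2 * b * r - d / r), 1, 0, 0],
             vector [1, 0, 0, 0],
             vector [0, 0, w, 0],
             vector [0, 0, 0, w]])"

abbreviation dx :: "(real^2 \<Rightarrow> real) \<Rightarrow> real^2 \<Rightarrow> real" where
  "dx \<equiv> pd 1"

abbreviation dy :: "(real^2 \<Rightarrow> real) \<Rightarrow> real^2 \<Rightarrow> real" where
  "dy \<equiv> pd 2"

definition F1 :: "(real^2 \<Rightarrow> real) \<Rightarrow> real^2 \<Rightarrow> real" where
  "F1 f z = (dx f z)^2 + (dy f z)^2 - f z * (dx (dx f) z + dy (dy f) z)"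

text \<open>Subscripts are read from left to right, so \<open>f\<^sub>x\<^sub>y\<^sub>y\<close> is \<open>dy (dy (dx f))\<close>.\<close>

definition RT_factor :: "real \<Rightarrow> (real^2 \<Rightarrow> real) \<Rightarrow> real^2 \<Rightarrow> real" where
  "RT_factor a f z =
     (8 * a * dx f z - 4 * (dy f z)^2 * dx f z + 3 * f z * dy (dy f) z * dx f z
      - 4 * (dx f z)^3 + 2 * f z * dy f z * dy (dx f) z - (f z)^2 * dy (dy (dx f)) z
      + 5 * f z * dx f z * dx (dx f) z - (f z)^2 * dx (dx (dx f)) z)
     / (f z * (F1 f z - 2 * a))"



lemma vector_4_nth:
  "(vector [u, v, w, z] :: 'a::zero^4) $ 1 = u" "(vector [u, v, w, z] :: 'a^4) $ 2 = v"
  "(vector [u, v, w, z] :: 'a^4) $ 3 = w" "(vector [u, v, w, z] :: 'a^4) $ 4 = z"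
  by (simp_all add: vector_def)

lemma RT_metric_nth:
  "RT_metric a b d f p $ i $ j =
    (if i = 1 \<and> j = 1 then - 2 * (a - 2 * b * p $ 2 - d / p $ 2)
     else if (i = 1 \<and> j = 2) \<or> (i = 2 \<and> j = 1) then 1
     else if (i = 3 \<and> j = 3) \<or> (i = 4 \<and> j = 4) then - ((p $ 2)^2 / (f (xy p))^2)
     else 0)"
  using exhaust_4[of i] exhaust_4[of j]
  by (auto simp: RT_metric_def Let_def vector_4_nth)

end

theory Submission
  imports Defs
begin

text \<open>For \<open>b = d = 0\<close> the metric is \<open>-2a dt\<^sup>2 + 2 dt dr - r\<^sup>2 h\<close>, a warped product of a flat Lorentzian
  plane with a surface whose metric is \<open>h = (dx\<^sup>2 + dy\<^sup>2) / f\<^sup>2\<close>. The warping function \<open>r\<close> is affine on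
  the flat plane, so the Hessian terms in the curvature of a warped product drop out and only the
  curvature of the surface directions survives. The curvature tensor therefore has a single
  component up to symmetries,
  \<open>R\<^sub>3\<^sub>4\<^sub>3\<^sub>4 = r\<^sup>2 (F1 - 2a) / f\<^sup>4\<close> (lemma \<open>riemann_eq\<close>).

  Since \<open>\<xi> = \<partial>\<^sub>x\<close> is a coordinate field, the Lie derivative of \<open>R\<close> is the partial derivative of its
  components in \<open>x\<close>. A tensor with one independent component, nowhere zero, is multiplied by the
  logarithmic derivative of that component, here
  \<open>\<partial>\<^sub>x (F1 - 2a) / (F1 - 2a) - 4 f\<^sub>x / f\<close>. Written out, this is the stated factor
  (lemma \<open>dx_curv\<close>), once the mixed third derivatives of \<open>f\<close> are put into one order, which uses
  the symmetry of second partial derivatives (lemma \<open>pd_commute\<close>). The factor is smooth because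
  smooth functions are closed under the field operations and under composition with the
  projection to \<open>(x, y)\<close>.\<close>

section \<open>Rules for partial derivatives\<close>

lemma has_pd_along_line:
  fixes h :: "real^'n::finite \<Rightarrow> real"
  assumes "h differentiable (at (q + s *\<^sub>R axis i 1))"
  shows "((\<lambda>t. h (q + t *\<^sub>R axis i 1)) has_real_derivative pd i h (q + s *\<^sub>R axis i 1)) (at s)"
proof -
  let ?e = "axis i 1 :: real^'n"
  from assms obtain D where D: "(h has_derivative D) (at (q + s *\<^sub>R ?e))"
    by (auto simp: differentiable_def)
  have lin: "D (t *\<^sub>R ?e) = t * D ?e" for t
    using linear_cmul[OF has_derivative_linear[OF D], of t ?e] by simp
  have along: "((\<lambda>t. h (q' + t *\<^sub>R ?e)) has_real_derivative D ?e) (at u)"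
    if "q' + u *\<^sub>R ?e = q + s *\<^sub>R ?e" for q' u
  proof -
    have "((\<lambda>t. q' + t *\<^sub>R ?e) has_derivative (\<lambda>t. t *\<^sub>R ?e)) (at u)"
      by (auto intro!: derivative_eq_intros)
    from has_derivative_compose[OF this, of h D] D that
    show ?thesis
      by (simp add: has_field_derivative_def lin mult_commute_abs)
  qed
  have "pd i h (q + s *\<^sub>R ?e) = D ?e"
    unfolding pd_def by (rule DERIV_imp_deriv, rule along) simp
  with along[of q s] show ?thesis by simp
qed

lemma has_pd:
  fixes h :: "real^'n::finite \<Rightarrow> real"
  assumes "h differentiable (at p)"
  shows "((\<lambda>t. h (p + t *\<^sub>R axis i 1)) has_real_derivative pd i h p) (at 0)"
  using has_pd_along_line[of h p 0 i] assms by simp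

lemma pd_eqI:
  "((\<lambda>t. h (p + t *\<^sub>R axis i 1)) has_real_derivative D) (at 0) \<Longrightarrow> pd i h p = D"
  unfolding pd_def by (rule DERIV_imp_deriv)

lemma pd_const [simp]: "pd i (\<lambda>_. c) p = 0"
  by (rule pd_eqI) simp

lemma pd_uminus:
  assumes "h differentiable (at p)"
  shows "pd i (\<lambda>q. - h q) p = - pd i h p"
  by (rule pd_eqI) (auto intro!: derivative_eq_intros has_pd assms)

lemma pd_add:
  assumes "h differentiable (at p)" "k differentiable (at p)"
  shows "pd i (\<lambda>q. h q + k q) p = pd i h p + pd i k p"
  by (rule pd_eqI) (auto intro!: derivative_eq_intros has_pd assms)

lemma pd_diff:
  assumes "h differentiable (at p)" "k differentiable (at p)"
  shows "pd i (\<lambda>q. h q - k q) p = pd i h p - pd i k p"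
  by (rule pd_eqI) (auto intro!: derivative_eq_intros has_pd assms)

lemma pd_mult:
  assumes "h differentiable (at p)" "k differentiable (at p)"
  shows "pd i (\<lambda>q. h q * k q) p = pd i h p * k p + h p * pd i k p"
  by (rule pd_eqI) (auto intro!: derivative_eq_intros has_pd assms)

lemma pd_power:
  assumes "h differentiable (at p)"
  shows "pd i (\<lambda>q. h q ^ n) p = n * h p ^ (n - 1) * pd i h p"
  by (rule pd_eqI) (auto intro!: derivative_eq_intros has_pd assms)

lemma pd_inverse:
  assumes "h differentiable (at p)" "h p \<noteq> 0"
  shows "pd i (\<lambda>q. inverse (h q)) p = - (pd i h p) * (inverse (h p) * inverse (h p))"
  by (rule pd_eqI) (auto intro!: derivative_eq_intros has_pd assms simp: assms)

lemma pd_divide: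
  assumes "h differentiable (at p)" "k differentiable (at p)" "k p \<noteq> 0"
  shows "pd i (\<lambda>q. h q / k q) p = (pd i h p * k p - h p * pd i k p) / (k p * k p)"
  by (rule pd_eqI) (auto intro!: derivative_eq_intros has_pd assms simp: assms)

lemma pd_cong:
  fixes S :: "(real^'n::finite) set"
  assumes "open S" "p \<in> S" "\<And>q. q \<in> S \<Longrightarrow> h q = k q"
  shows "pd i h p = pd i k p"
proof -
  have "((\<lambda>t. p + t *\<^sub>R axis i 1) \<longlongrightarrow> p + 0 *\<^sub>R axis i 1) (nhds (0::real))"
    by (intro tendsto_intros filterlim_ident)
  with assms(1,2) have "\<forall>\<^sub>F t in nhds (0::real). p + t *\<^sub>R axis i 1 \<in> S"
    by (simp add: topological_tendstoD)
  then show ?thesis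
    unfolding pd_def by (intro deriv_cong_ev) (auto elim!: eventually_mono simp: assms(3))
qed

section \<open>Symmetry of second partial derivatives\<close>

text \<open>The mean value theorem, used once in each direction, turns the second difference over a square
  of side \<open>\<delta>\<close> into a mixed derivative at an interior point. The second difference is unchanged
  when the two directions are exchanged, which is what gives the symmetry below.\<close>

lemma second_difference:
  fixes h :: "real^'n::finite \<Rightarrow> real"
  assumes \<delta>: "0 < \<delta>"
    and in_S: "\<And>s t. \<lbrakk>0 \<le> s; s \<le> \<delta>; 0 \<le> t; t \<le> \<delta>\<rbrakk>
      \<Longrightarrow> p + s *\<^sub>R axis i 1 + t *\<^sub>R axis j 1 \<in> S"
    and h: "\<And>q. q \<in> S \<Longrightarrow> h differentiable (at q)"
    and pdh: "\<And>q. q \<in> S \<Longrightarrow> pd i h differentiable (at q)"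
  obtains s t where "0 < s" "s < \<delta>" "0 < t" "t < \<delta>"
    and "h (p + \<delta> *\<^sub>R axis i 1 + \<delta> *\<^sub>R axis j 1) - h (p + \<delta> *\<^sub>R axis j 1)
           - (h (p + \<delta> *\<^sub>R axis i 1) - h p)
         = \<delta>\<^sup>2 * pd j (pd i h) (p + s *\<^sub>R axis i 1 + t *\<^sub>R axis j 1)"
proof -
  let ?ei = "axis i 1 :: real^'n" and ?ej = "axis j 1 :: real^'n"
  let ?\<phi> = "\<lambda>s. h (p + \<delta> *\<^sub>R ?ej + s *\<^sub>R ?ei) - h (p + s *\<^sub>R ?ei)"
  let ?\<phi>' = "\<lambda>s. pd i h (p + \<delta> *\<^sub>R ?ej + s *\<^sub>R ?ei) - pd i h (p + s *\<^sub>R ?ei)"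
  have "\<exists>z>0. z < \<delta> \<and> ?\<phi> \<delta> - ?\<phi> 0 = (\<delta> - 0) * ?\<phi>' z"
  proof (rule MVT2[OF \<delta>])
    fix s assume "0 \<le> s" "s \<le> \<delta>"
    with in_S[of s 0] in_S[of s \<delta>] \<delta>
    have "p + s *\<^sub>R ?ei \<in> S" "p + \<delta> *\<^sub>R ?ej + s *\<^sub>R ?ei \<in> S"
      by (simp_all add: algebra_simps)
    then show "(?\<phi> has_real_derivative ?\<phi>' s) (at s)"
      by (intro DERIV_diff has_pd_along_line h)
  qed
  then obtain s where s: "0 < s" "s < \<delta>" "?\<phi> \<delta> - ?\<phi> 0 = \<delta> * ?\<phi>' s" by auto
  let ?\<psi> = "\<lambda>t. pd i h (p + s *\<^sub>R ?ei + t *\<^sub>R ?ej)"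
  have "\<exists>z>0. z < \<delta> \<and> ?\<psi> \<delta> - ?\<psi> 0 = (\<delta> - 0) * pd j (pd i h) (p + s *\<^sub>R ?ei + z *\<^sub>R ?ej)"
    by (rule MVT2[OF \<delta>]) (use s in_S in \<open>intro has_pd_along_line pdh; simp\<close>)
  then obtain t where t: "0 < t" "t < \<delta>"
      "?\<psi> \<delta> - ?\<psi> 0 = \<delta> * pd j (pd i h) (p + s *\<^sub>R ?ei + t *\<^sub>R ?ej)" by auto
  have "p + \<delta> *\<^sub>R ?ej + s *\<^sub>R ?ei = p + s *\<^sub>R ?ei + \<delta> *\<^sub>R ?ej"
       "p + \<delta> *\<^sub>R ?ej + \<delta> *\<^sub>R ?ei = p + \<delta> *\<^sub>R ?ei + \<delta> *\<^sub>R ?ej" by (simp_all add: algebra_simps)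
  with s(3) t(3) have "h (p + \<delta> *\<^sub>R ?ei + \<delta> *\<^sub>R ?ej) - h (p + \<delta> *\<^sub>R ?ej) - (h (p + \<delta> *\<^sub>R ?ei) - h p)
      = \<delta>\<^sup>2 * pd j (pd i h) (p + s *\<^sub>R ?ei + t *\<^sub>R ?ej)"
    by (simp add: power2_eq_square)
  with s t show ?thesis by (intro that[of s t])
qed

text \<open>Both mixed derivatives represent the same second difference, at two points of an arbitrarily
  small square at \<open>p\<close>; as they are continuous, they agree at \<open>p\<close>.\<close>

lemma pd_commute:
  fixes h :: "real^'n::finite \<Rightarrow> real"
  assumes S: "open S" "p \<in> S" and h: "Ck_on 2 S h"
  shows "pd i (pd j h) p = pd j (pd i h) p"
proof (rule ccontr)
  assume neq: "pd i (pd j h) p \<noteq> pd j (pd i h) p"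
  define \<epsilon> where "\<epsilon> = \<bar>pd i (pd j h) p - pd j (pd i h) p\<bar> / 2"
  have "\<epsilon> > 0" using neq by (simp add: \<epsilon>_def)
  have diff: "\<And>q. q \<in> S \<Longrightarrow> h differentiable (at q)"
    "\<And>q k. q \<in> S \<Longrightarrow> pd k h differentiable (at q)"
    and cont: "\<And>k l. continuous_on S (pd k (pd l h))"
    using h by (simp_all add: numeral_2_eq_2)
  have "isCont (pd k (pd l h)) p" for k l
    using cont S by (simp add: continuous_on_eq_continuous_at)
  then have "\<exists>d>0. \<forall>q. dist q p < d \<longrightarrow> dist (pd k (pd l h) q) (pd k (pd l h) p) < \<epsilon>" for k l
    using \<open>\<epsilon> > 0\<close> unfolding continuous_at_eps_delta by blast
  then obtain d where d: "\<And>k l. d k l > 0"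
    "\<And>k l q. dist q p < d k l \<Longrightarrow> dist (pd k (pd l h) q) (pd k (pd l h) p) < \<epsilon>"
    by metis
  obtain \<rho> where \<rho>: "\<rho> > 0" "ball p \<rho> \<subseteq> S" using S open_contains_ball by metis
  \<comment> \<open>The points of the square lie within \<open>2 \<delta>\<close> of \<open>p\<close>, so a third of the radii suffices.\<close>
  define \<delta> where "\<delta> = min \<rho> (min (d i j) (d j i)) / 3"
  have \<delta>: "\<delta> > 0" "2 * \<delta> < \<rho>" "2 * \<delta> < d i j" "2 * \<delta> < d j i"
    using \<rho>(1) d(1)[of i j] d(1)[of j i] by (auto simp: \<delta>_def min_def)
  have near: "dist (p + s *\<^sub>R axis k 1 + t *\<^sub>R axis l 1) p \<le> 2 * \<delta>"
    if "0 \<le> s" "s \<le> \<delta>" "0 \<le> t" "t \<le> \<delta>" for s t k l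
  proof -
    have "dist (p + s *\<^sub>R axis k 1 + t *\<^sub>R axis l 1) p
        = norm (s *\<^sub>R axis k 1 + t *\<^sub>R axis l 1 :: real^'n)"
      by (simp add: dist_norm add.assoc)
    also have "\<dots> \<le> \<bar>s\<bar> + \<bar>t\<bar>"
      using norm_triangle_ineq[of "s *\<^sub>R axis k 1 :: real^'n" "t *\<^sub>R axis l 1"] by simp
    finally show ?thesis using that by linarith
  qed
  have in_S: "p + s *\<^sub>R axis k 1 + t *\<^sub>R axis l 1 \<in> S"
    if "0 \<le> s" "s \<le> \<delta>" "0 \<le> t" "t \<le> \<delta>" for s t k l
    using near[OF that, of k l] \<delta>(2) \<rho>(2) by (auto simp: dist_commute subset_eq)
  obtain s t where st: "0 < s" "s < \<delta>" "0 < t" "t < \<delta>"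
    "h (p + \<delta> *\<^sub>R axis i 1 + \<delta> *\<^sub>R axis j 1) - h (p + \<delta> *\<^sub>R axis j 1)
       - (h (p + \<delta> *\<^sub>R axis i 1) - h p)
     = \<delta>\<^sup>2 * pd j (pd i h) (p + s *\<^sub>R axis i 1 + t *\<^sub>R axis j 1)"
    by (rule second_difference[of \<delta> p i j S h]) (use \<delta>(1) in_S diff in auto)
  obtain s' t' where st': "0 < s'" "s' < \<delta>" "0 < t'" "t' < \<delta>"
    "h (p + \<delta> *\<^sub>R axis j 1 + \<delta> *\<^sub>R axis i 1) - h (p + \<delta> *\<^sub>R axis i 1)
       - (h (p + \<delta> *\<^sub>R axis j 1) - h p)
     = \<delta>\<^sup>2 * pd i (pd j h) (p + s' *\<^sub>R axis j 1 + t' *\<^sub>R axis i 1)"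
    by (rule second_difference[of \<delta> p j i S h]) (use \<delta>(1) in_S diff in auto)
  have swap: "p + \<delta> *\<^sub>R axis j 1 + \<delta> *\<^sub>R axis i 1 = p + \<delta> *\<^sub>R axis i 1 + \<delta> *\<^sub>R axis j 1"
    by (simp add: algebra_simps)
  let ?q = "p + s *\<^sub>R axis i 1 + t *\<^sub>R axis j 1"
  let ?q' = "p + s' *\<^sub>R axis j 1 + t' *\<^sub>R axis i 1"
  have "\<delta>\<^sup>2 * pd j (pd i h) ?q = \<delta>\<^sup>2 * pd i (pd j h) ?q'"
    using st(5) st'(5) unfolding swap by linarith
  then have "pd j (pd i h) ?q = pd i (pd j h) ?q'" using \<delta>(1) by simp
  moreover have "dist (pd j (pd i h) ?q) (pd j (pd i h) p) < \<epsilon>"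
    using near[of s t i j] st \<delta> by (intro d(2)) auto
  moreover have "dist (pd i (pd j h) ?q') (pd i (pd j h) p) < \<epsilon>"
    using near[of s' t' j i] st' \<delta> by (intro d(2)) auto
  moreover have "\<bar>pd i (pd j h) p - pd j (pd i h) p\<bar> = 2 * \<epsilon>" by (simp add: \<epsilon>_def)
  ultimately show False
    unfolding dist_real_def by linarith
qed

section \<open>Closure properties of smooth functions\<close>

lemma Ck_on_cong:
  assumes "open S" "\<And>p. p \<in> S \<Longrightarrow> h p = h' p" "Ck_on k S h"
  shows "Ck_on k S h'"
  using assms(2,3)
proof (induction k arbitrary: h h')
  case 0
  then show ?case using continuous_on_cong[of S S h h'] by simp
next
  case (Suc k)
  have "Ck_on k S (pd i h')" for i
    by (rule Suc.IH[of "pd i h"]) (use Suc.prems pd_cong[OF assms(1), of _ h h' i] in auto)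
  moreover have "h' differentiable (at p)" if "p \<in> S" for p
  proof -
    from Suc.prems(2) that have "h differentiable (at p)" by simp
    then obtain D where "(h has_derivative D) (at p)"
      unfolding differentiable_def by blast
    then have "(h' has_derivative D) (at p)"
      by (rule has_derivative_transform_within_open[OF _ assms(1) that]) (use Suc.prems in auto)
    then show ?thesis by (auto simp: differentiable_def)
  qed
  ultimately show ?case by simp
qed

lemma
  assumes "Ck_on (Suc k) S h"
  shows Ck_on_Suc_differentiable: "p \<in> S \<Longrightarrow> h differentiable (at p)"
    and Ck_on_Suc_pd: "Ck_on k S (pd i h)"
  using assms by simp_all

lemma Ck_on_Suc_imp: "Ck_on (Suc k) S h \<Longrightarrow> Ck_on k S h"
proof (induction k arbitrary: h)
  case 0
  have "isCont h p" if "p \<in> S" for p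
    by (rule differentiable_imp_continuous_within[OF Ck_on_Suc_differentiable[OF 0 that]])
  then have "continuous_on S h" by (intro continuous_at_imp_continuous_on ballI)
  then show ?case by (simp only: Ck_on.simps(1))
next
  case (Suc k)
  have "Ck_on k S (pd i h)" for i
    by (rule Suc.IH, rule Ck_on_Suc_pd, rule Suc.prems)
  moreover have "h differentiable (at p)" if "p \<in> S" for p
    by (rule Ck_on_Suc_differentiable[OF Suc.prems that])
  ultimately show ?case by simp
qed

lemmas Ck_on_SucD = Ck_on_Suc_differentiable Ck_on_Suc_pd Ck_on_Suc_imp

text \<open>The form in which the product and quotient rules are used in inductions on \<open>k\<close>: the formula \<open>h'\<close>
  for the partial derivatives is needed only on the open set \<open>S\<close>, since \<open>pd i h\<close> is
  unspecified at points where \<open>h\<close> is not differentiable.\<close>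

lemma Ck_on_SucI:
  assumes "open S" "\<And>p. p \<in> S \<Longrightarrow> h differentiable (at p)"
    and "\<And>i p. p \<in> S \<Longrightarrow> h' i p = pd i h p" "\<And>i. Ck_on k S (h' i)"
  shows "Ck_on (Suc k) S h"
proof -
  have "Ck_on k S (pd i h)" for i
    by (rule Ck_on_cong[where h = "h' i", OF assms(1)]) (simp_all add: assms(3,4))
  with assms(2) show ?thesis by simp
qed

lemma Ck_on_const: "Ck_on k S (\<lambda>_. c)"
proof (induction k arbitrary: c)
  case (Suc k)
  have "pd i (\<lambda>_. c) = (\<lambda>_. 0)" for i :: 'a by (rule ext) simp
  with Suc show ?case by simp
qed simp

lemma Ck_on_uminus:
  assumes "open S" "Ck_on k S h"
  shows "Ck_on k S (\<lambda>p. - h p)"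
  using assms(2)
proof (induction k arbitrary: h)
  case 0
  then show ?case by (simp add: continuous_on_minus)
next
  case (Suc k)
  note h = Ck_on_SucD[OF Suc.prems]
  show ?case
  proof (rule Ck_on_SucI[OF assms(1)])
    show "Ck_on k S (\<lambda>p. - pd i h p)" for i by (intro Suc.IH h)
  qed (simp_all add: h pd_uminus)
qed

lemma Ck_on_add:
  assumes "open S" "Ck_on k S h" "Ck_on k S k'"
  shows "Ck_on k S (\<lambda>p. h p + k' p)"
  using assms(2,3)
proof (induction k arbitrary: h k')
  case 0
  then show ?case by (simp add: continuous_on_add)
next
  case (Suc k)
  note h = Ck_on_SucD[OF Suc.prems(1)] Ck_on_SucD[OF Suc.prems(2)]
  show ?case
  proof (rule Ck_on_SucI[OF assms(1)])
    show "Ck_on k S (\<lambda>p. pd i h p + pd i k' p)" for i by (intro Suc.IH h)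
  qed (simp_all add: h pd_add)
qed

lemma Ck_on_mult:
  assumes "open S" "Ck_on k S h" "Ck_on k S k'"
  shows "Ck_on k S (\<lambda>p. h p * k' p)"
  using assms(2,3)
proof (induction k arbitrary: h k')
  case 0
  then show ?case by (simp add: continuous_on_mult)
next
  case (Suc k)
  note h = Ck_on_SucD[OF Suc.prems(1)] Ck_on_SucD[OF Suc.prems(2)]
  show ?case
  proof (rule Ck_on_SucI[OF assms(1)])
    show "Ck_on k S (\<lambda>p. pd i h p * k' p + h p * pd i k' p)" for i
      by (intro Ck_on_add assms(1) Suc.IH h)
  qed (simp_all add: h pd_mult)
qed

lemma Ck_on_inverse:
  assumes "open S" "\<forall>p\<in>S. h p \<noteq> 0" "Ck_on k S h"
  shows "Ck_on k S (\<lambda>p. inverse (h p))"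
  using assms(3)
proof (induction k)
  case 0
  with assms(2) show ?case by (simp add: continuous_on_inverse)
next
  case (Suc k)
  note h = Ck_on_SucD[OF Suc.prems]
  show ?case
  proof (rule Ck_on_SucI[OF assms(1)])
    show "Ck_on k S (\<lambda>p. - pd i h p * (inverse (h p) * inverse (h p)))" for i
      by (intro Ck_on_mult Ck_on_uminus assms(1) Suc.IH h)
  qed (use assms(2) in \<open>simp_all add: h pd_inverse\<close>)
qed

lemma smooth_on_Ck_on: "smooth_on S h \<Longrightarrow> Ck_on k S h"
  by (simp add: smooth_on_def)

lemma smooth_on_pd: "smooth_on S h \<Longrightarrow> smooth_on S (pd i h)"
  by (auto simp: smooth_on_def intro: Ck_on_Suc_pd)

lemma smooth_on_differentiable: "smooth_on S h \<Longrightarrow> p \<in> S \<Longrightarrow> h differentiable (at p)"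
  by (auto simp: smooth_on_def dest: spec[of _ "Suc 0"])

lemma smooth_on_const: "smooth_on S (\<lambda>_. c)"
  by (simp add: smooth_on_def Ck_on_const)

lemma smooth_on_add: "open S \<Longrightarrow> smooth_on S h \<Longrightarrow> smooth_on S k \<Longrightarrow> smooth_on S (\<lambda>p. h p + k p)"
  by (simp add: smooth_on_def Ck_on_add)

lemma smooth_on_mult: "open S \<Longrightarrow> smooth_on S h \<Longrightarrow> smooth_on S k \<Longrightarrow> smooth_on S (\<lambda>p. h p * k p)"
  by (simp add: smooth_on_def Ck_on_mult)

lemma smooth_on_diff: "open S \<Longrightarrow> smooth_on S h \<Longrightarrow> smooth_on S k \<Longrightarrow> smooth_on S (\<lambda>p. h p - k p)"
  using smooth_on_add[of S h "\<lambda>p. - k p"] by (simp add: smooth_on_def Ck_on_uminus)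

lemma smooth_on_power: "open S \<Longrightarrow> smooth_on S h \<Longrightarrow> smooth_on S (\<lambda>p. h p ^ n)"
  by (induction n) (simp_all add: smooth_on_const smooth_on_mult)

lemma smooth_on_divide:
  assumes "open S" "smooth_on S h" "smooth_on S k" "\<forall>p\<in>S. k p \<noteq> 0"
  shows "smooth_on S (\<lambda>p. h p / k p)"
  using assms by (simp add: divide_inverse smooth_on_def Ck_on_mult Ck_on_inverse)

lemmas smooth_on_intros =
  smooth_on_const smooth_on_add smooth_on_diff smooth_on_mult smooth_on_power smooth_on_divide
  smooth_on_pd

section \<open>Functions of the last two coordinates\<close>

lemma xy_line:
  "xy (p + t *\<^sub>R axis 1 1) = xy p" "xy (p + t *\<^sub>R axis 2 1) = xy p"
  "xy (p + t *\<^sub>R axis 3 1) = xy p + t *\<^sub>R axis 1 1"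
  "xy (p + t *\<^sub>R axis 4 1) = xy p + t *\<^sub>R axis 2 1"
  by (simp_all add: xy_def vec_eq_iff forall_2 axis_def vector_2)

text \<open>A partial derivative is a derivative along a coordinate line, which \<open>xy\<close> maps to a coordinate
  line or to a point; hence these equations hold for every function \<open>h\<close>.\<close>

lemma pd_comp_xy:
  "pd 1 (\<lambda>p. h (xy p)) = (\<lambda>p. 0)" "pd 2 (\<lambda>p. h (xy p)) = (\<lambda>p. 0)"
  "pd 3 (\<lambda>p. h (xy p)) = (\<lambda>p. pd 1 h (xy p))" "pd 4 (\<lambda>p. h (xy p)) = (\<lambda>p. pd 2 h (xy p))"
  by (rule ext, simp add: pd_def xy_line)+

lemma pd_component2:
  "pd i (\<lambda>p. p $ 2) = (\<lambda>p::real^4. if i = 2 then 1 else 0)"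
  by (rule ext, rule pd_eqI) (auto intro!: derivative_eq_intros simp: axis_def)

lemma linear_xy: "linear xy"
  by (rule linearI) (simp_all add: xy_def vec_eq_iff forall_2 vector_2)

lemma differentiable_comp_xy:
  assumes "h differentiable (at (xy p))"
  shows "(\<lambda>p. h (xy p)) differentiable (at p)"
proof -
  have "xy differentiable (at p)"
    by (rule linear_imp_differentiable[OF linear_xy])
  from differentiable_chain_at[OF this assms] show ?thesis by (simp add: o_def)
qed

lemma Ck_on_comp_xy:
  assumes "xy ` S \<subseteq> T"
  shows "Ck_on k T h \<Longrightarrow> Ck_on k S (\<lambda>p. h (xy p))"
proof (induction k arbitrary: h)
  case 0
  have "continuous_on S xy"
    using linear_continuous_on linear_linear linear_xy by blast
  with 0 assms show ?case
    using continuous_on_compose2[of T h S xy] by simp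
next
  case (Suc k)
  have "Ck_on k S (pd i (\<lambda>p. h (xy p)))" for i
    using exhaust_4[of i] Suc by (auto simp: pd_comp_xy Ck_on_const)
  with Suc.prems assms show ?case by (auto intro: differentiable_comp_xy)
qed

lemma smooth_on_comp_xy: "smooth_on T h \<Longrightarrow> xy ` S \<subseteq> T \<Longrightarrow> smooth_on S (\<lambda>p. h (xy p))"
  by (simp add: smooth_on_def Ck_on_comp_xy)

lemma open_RT_domain:
  assumes "open I" "open J" "open \<Omega>"
  shows "open (RT_domain I J \<Omega>)"
proof -
  have "continuous_on UNIV xy"
    using linear_continuous_on linear_linear linear_xy by blast
  then have "open (xy -` \<Omega>)" using assms(3) by (rule open_vimage[rotated])
  moreover have "open ((\<lambda>p::real^4. p $ 1) -` I)" "open ((\<lambda>p::real^4. p $ 2) -` J)"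
    by (intro open_vimage assms continuous_intros)+
  moreover have "RT_domain I J \<Omega> = (\<lambda>p. p $ 1) -` I \<inter> (\<lambda>p. p $ 2) -` J \<inter> xy -` \<Omega>"
    by (auto simp: RT_domain_def)
  ultimately show ?thesis by (auto intro: open_Int)
qed

section \<open>General facts on metrics and curvature\<close>

lemma matrix_inv_unique:
  fixes A B :: "real^'n^'n"
  assumes "A ** B = mat 1"
  shows "matrix_inv A = B"
proof -
  have "B ** A = mat 1" using assms by (simp add: matrix_left_right_inverse)
  then have "invertible A" using assms by (auto simp: invertible_def)
  then have "matrix_inv A ** A = mat 1"
    unfolding matrix_inv_def invertible_def by (rule someI2_ex) simp
  then have "matrix_inv A ** (A ** B) = B" by (simp add: matrix_mul_assoc)
  with assms show ?thesis by simp
qed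

lemma riemann_antisym: "riemann h i j k l p = - riemann h i j l k p"
  by (simp add: riemann_def sum_negf[symmetric] algebra_simps)

lemma lie_derivative_axis:
  "lie_derivative (\<lambda>_. axis i 1) T p q r s x = pd i (T p q r s) x"
  by (simp add: lie_derivative_def axis_def if_distrib[of "\<lambda>c. c * _"] cong: if_cong)

section \<open>The curvature coefficient and its logarithmic derivative\<close>

text \<open>The name refers to the metric \<open>-2a dt\<^sup>2 + 2 dt dr - r\<^sup>2 h\<close> of the case \<open>b = d = 0\<close>: the surface
  metric \<open>h\<close> is scaled by \<open>r\<^sup>2\<close>, as in a cone over the surface.\<close>

locale RT_cone =
  fixes a :: real and I J :: "real set" and \<Omega> :: "(real^2) set" and f :: "real^2 \<Rightarrow> real"
  assumes I: "open I" "I \<noteq> {}" and J: "open J" "J \<noteq> {}" "0 \<notin> J"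
    and \<Omega>: "open \<Omega>" and f_smooth: "smooth_on \<Omega> f" and f_nonzero: "z \<in> \<Omega> \<Longrightarrow> f z \<noteq> 0"
    and F1_nondeg: "p \<in> RT_domain I J \<Omega> \<Longrightarrow> F1 f (xy p) \<noteq> 2 * a"
begin

abbreviation "M \<equiv> RT_domain I J \<Omega>"
abbreviation "g \<equiv> RT_metric a 0 0 f"

lemma M: "open M" "p \<in> M \<Longrightarrow> p $ 2 \<noteq> 0" "p \<in> M \<Longrightarrow> xy p \<in> \<Omega>"
  using J open_RT_domain[OF I(1) J(1) \<Omega>] by (auto simp: RT_domain_def)

text \<open>As \<open>I\<close> and \<open>J\<close> are nonempty, every point of \<open>\<Omega>\<close> lies below a point of \<open>M\<close>.\<close>

lemma F1_nondeg_on_Omega: "z \<in> \<Omega> \<Longrightarrow> F1 f z \<noteq> 2 * a"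
proof -
  assume z: "z \<in> \<Omega>"
  obtain i j where "i \<in> I" "j \<in> J" using I J by blast
  moreover define p :: "real^4" where "p = vector [i, j, z $ 1, z $ 2]"
  moreover have "xy p = z"
    by (simp add: p_def xy_def vector_4_nth vec_eq_iff forall_2 vector_2)
  ultimately have "p \<in> M" using z by (simp add: RT_domain_def vector_4_nth)
  with F1_nondeg[of p] \<open>xy p = z\<close> show ?thesis by simp
qed

lemma smooth_F1: "smooth_on \<Omega> (F1 f)"
  unfolding F1_def[abs_def] by (intro smooth_on_intros \<Omega> f_smooth)

lemma smooth_RT_factor: "smooth_on \<Omega> (RT_factor a f)"
  unfolding RT_factor_def[abs_def]
  by (intro smooth_on_intros \<Omega> f_smooth smooth_F1) (auto simp: f_nonzero F1_nondeg_on_Omega)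

text \<open>The third derivative of \<open>f\<close> appears in the stated factor as \<open>f\<^sub>x\<^sub>y\<^sub>y\<close>, but differentiating \<open>F1\<close>
  in \<open>x\<close> produces \<open>f\<^sub>y\<^sub>y\<^sub>x\<close>; moving \<open>x\<close> to the front takes two exchanges.\<close>

lemma partials_commute:
  assumes "z \<in> \<Omega>"
  shows "dx (dy f) z = dy (dx f) z" "dx (dy (dy f)) z = dy (dy (dx f)) z"
proof -
  have comm: "dx (dy h) w = dy (dx h) w" if "w \<in> \<Omega>" "smooth_on \<Omega> h" for h w
    using \<Omega> that by (intro pd_commute smooth_on_Ck_on)
  show "dx (dy f) z = dy (dx f) z" by (intro comm assms f_smooth)
  have "dx (dy (dy f)) z = dy (dx (dy f)) z" by (intro comm assms smooth_on_pd f_smooth)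
  also have "\<dots> = dy (dy (dx f)) z"
    by (rule pd_cong[OF \<Omega> assms]) (rule comm[OF _ f_smooth])
  finally show "dx (dy (dy f)) z = dy (dy (dx f)) z" .
qed

text \<open>The Gauss curvature of \<open>h\<close> is \<open>f (f\<^sub>x\<^sub>x + f\<^sub>y\<^sub>y) - f\<^sub>x\<^sup>2 - f\<^sub>y\<^sup>2\<close>, the negative of \<open>F1\<close>, and the
  squared gradient of the warping function \<open>r\<close> is \<open>2a\<close>. The Gauss equation of the warped product
  combines the two into \<open>F1 - 2a\<close>; the factor \<open>1 / f\<^sup>4\<close> is the square of the area density of \<open>h\<close>.\<close>

definition curv :: "real^2 \<Rightarrow> real" where
  "curv z = (F1 f z - 2 * a) / f z ^ 4"

lemmas diff_Omega = smooth_on_differentiable[of \<Omega>]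

lemma dx_F1:
  assumes "z \<in> \<Omega>"
  shows "dx (F1 f) z = 2 * dx f z * dx (dx f) z + 2 * dy f z * dy (dx f) z
    - dx f z * (dx (dx f) z + dy (dy f) z) - f z * (dx (dx (dx f)) z + dy (dy (dx f)) z)"
proof -
  have [simp]: "f differentiable (at z)" "pd i f differentiable (at z)"
    "pd i (pd j f) differentiable (at z)" for i j
    using assms by (auto intro!: diff_Omega smooth_on_pd f_smooth)
  show ?thesis
    unfolding F1_def[abs_def]
    by (simp add: pd_diff pd_add pd_mult pd_power partials_commute[OF assms] algebra_simps)
qed

text \<open>This is where the stated factor comes from: it is the logarithmic derivative in \<open>x\<close>
  of \<open>curv\<close>, that is
  \<open>\<partial>\<^sub>x (F1 - 2a) / (F1 - 2a) - 4 f\<^sub>x / f\<close>, brought to the common denominator \<open>f (F1 - 2a)\<close>.\<close>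

lemma dx_curv:
  assumes "z \<in> \<Omega>"
  shows "dx curv z = RT_factor a f z * curv z"
proof -
  have 1: "f differentiable (at z)" "F1 f differentiable (at z)"
    using assms by (auto intro!: diff_Omega f_smooth smooth_F1)
  have nz: "f z \<noteq> 0" "F1 f z - 2 * a \<noteq> 0" using f_nonzero F1_nondeg_on_Omega assms by auto
  have "dx curv z = (dx (F1 f) z * f z - 4 * (F1 f z - 2 * a) * dx f z) / f z ^ 5"
    unfolding curv_def[abs_def] using 1 nz
    by (simp add: pd_divide pd_diff pd_power, simp add: field_simps power_numeral_reduce)
  also have "dx (F1 f) z * f z - 4 * (F1 f z - 2 * a) * dx f z
      = RT_factor a f z * (f z * (F1 f z - 2 * a))"
  proof -
    have "RT_factor a f z * (f z * (F1 f z - 2 * a)) =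
      8 * a * dx f z - 4 * (dy f z)^2 * dx f z + 3 * f z * dy (dy f) z * dx f z
      - 4 * (dx f z)^3 + 2 * f z * dy f z * dy (dx f) z - (f z)^2 * dy (dy (dx f)) z
      + 5 * f z * dx f z * dx (dx f) z - (f z)^2 * dx (dx (dx f)) z"
      using nz by (simp add: RT_factor_def)
    then show ?thesis
      by (simp add: dx_F1[OF assms] F1_def algebra_simps power2_eq_square power3_eq_cube)
  qed
  finally show ?thesis
    using nz by (simp add: curv_def[of z] eval_nat_numeral)
qed

section \<open>Christoffel symbols\<close>

lemma metric_nth: "g p $ i $ j =
    (if i = 1 \<and> j = 1 then - 2 * a
     else if (i = 1 \<and> j = 2) \<or> (i = 2 \<and> j = 1) then 1
     else if (i = 3 \<and> j = 3) \<or> (i = 4 \<and> j = 4) then - ((p $ 2)^2 / (f (xy p))^2)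
     else 0)"
  by (simp add: RT_metric_nth)

lemma inverse_metric_nth:
  assumes "p \<in> M"
  shows "matrix_inv (g p) $ i $ j =
    (if i = 2 \<and> j = 2 then 2 * a
     else if (i = 1 \<and> j = 2) \<or> (i = 2 \<and> j = 1) then 1
     else if (i = 3 \<and> j = 3) \<or> (i = 4 \<and> j = 4) then - ((f (xy p))^2 / (p $ 2)^2)
     else 0)" (is "_ = ?c i j")
proof -
  have "p $ 2 \<noteq> 0" "f (xy p) \<noteq> 0" using M assms f_nonzero by auto
  then have "g p ** (\<chi> i j. ?c i j) = mat 1"
    by (simp add: vec_eq_iff matrix_matrix_mult_def sum_4 forall_4 metric_nth mat_def)
  then have "matrix_inv (g p) = (\<chi> i j. ?c i j)" by (rule matrix_inv_unique)
  then show ?thesis by simp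
qed

lemma differentiable_M:
  assumes "p \<in> M"
  shows "(\<lambda>p. f (xy p)) differentiable (at p)"
    "(\<lambda>p. pd i f (xy p)) differentiable (at p)"
    "(\<lambda>p::real^4. p $ 2) differentiable (at p)"
proof -
  show "(\<lambda>p. f (xy p)) differentiable (at p)" "(\<lambda>p. pd i f (xy p)) differentiable (at p)"
    by (intro differentiable_comp_xy diff_Omega f_smooth smooth_on_pd M(3) assms)+
  show "(\<lambda>p::real^4. p $ 2) differentiable (at p)"
    by (intro bounded_linear_imp_differentiable bounded_linear_vec_nth)
qed

lemma pd_metric:
  assumes "p \<in> M"
  shows "pd l (\<lambda>q. g q $ i $ j) p =
    (if i = j \<and> (i = 3 \<or> i = 4) then
       if l = 2 then - 2 * p $ 2 / (f (xy p))^2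
       else if l = 3 then 2 * (p $ 2)^2 * dx f (xy p) / (f (xy p))^3
       else if l = 4 then 2 * (p $ 2)^2 * dy f (xy p) / (f (xy p))^3
       else 0
     else 0)"
proof -
  have nz: "p $ 2 \<noteq> 0" "f (xy p) \<noteq> 0" using M assms f_nonzero by auto
  have "pd l (\<lambda>q. - ((q $ 2)^2 / (f (xy q))^2)) p =
       (if l = 2 then - 2 * p $ 2 / (f (xy p))^2
       else if l = 3 then 2 * (p $ 2)^2 * dx f (xy p) / (f (xy p))^3
       else if l = 4 then 2 * (p $ 2)^2 * dy f (xy p) / (f (xy p))^3
       else 0)"
    using nz differentiable_M[OF assms] exhaust_4[of l]
    by (elim disjE; simp add: pd_uminus pd_divide pd_power pd_component2 pd_comp_xy;
        simp add: field_simps power_numeral_reduce)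
  then show ?thesis
    using exhaust_4[of i] exhaust_4[of j] by (elim disjE; simp add: metric_nth)
qed

text \<open>The Christoffel symbols \<open>\<Gamma>\<^sup>i\<^sub>j\<^sub>k\<close> are given as functions of the point, so that they can be
  differentiated again entry by entry.\<close>

definition Gam :: "4 \<Rightarrow> 4 \<Rightarrow> 4 \<Rightarrow> real^4 \<Rightarrow> real" where
  "Gam i j k =
    (if j = k \<and> (j = 3 \<or> j = 4) \<and> i = 1 then (\<lambda>p. p $ 2 / (f (xy p))^2)
     else if j = k \<and> (j = 3 \<or> j = 4) \<and> i = 2 then (\<lambda>p. 2 * a * p $ 2 / (f (xy p))^2)
     else if (i = 3 \<or> i = 4) \<and> (j = 2 \<and> k = i \<or> j = i \<and> k = 2) then (\<lambda>p. 1 / p $ 2)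
     else if i = 3 \<and> j = 4 \<and> k = 4 then (\<lambda>p. dx f (xy p) / f (xy p))
     else if i = 4 \<and> j = 3 \<and> k = 3 then (\<lambda>p. dy f (xy p) / f (xy p))
     else if i = 3 \<and> j = 3 \<and> k = 3 \<or> i = 4 \<and> (j = 3 \<and> k = 4 \<or> j = 4 \<and> k = 3)
       then (\<lambda>p. - (dx f (xy p) / f (xy p)))
     else if i = 4 \<and> j = 4 \<and> k = 4 \<or> i = 3 \<and> (j = 3 \<and> k = 4 \<or> j = 4 \<and> k = 3)
       then (\<lambda>p. - (dy f (xy p) / f (xy p)))
     else (\<lambda>p. 0))"

text \<open>The definition by cases as a table of rewrite rules. Looking up entries by matching keeps the
  sums in the curvature components tractable, where deciding the index conditions of every
  summand would not.\<close>

lemma Gam_zero: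
  "Gam i 1 k = (\<lambda>p. 0)" "Gam i j 1 = (\<lambda>p. 0)" "Gam i 2 2 = (\<lambda>p. 0)"
  "Gam 1 2 k = (\<lambda>p. 0)" "Gam 1 j 2 = (\<lambda>p. 0)" "Gam 1 3 4 = (\<lambda>p. 0)" "Gam 1 4 3 = (\<lambda>p. 0)"
  "Gam 2 2 k = (\<lambda>p. 0)" "Gam 2 j 2 = (\<lambda>p. 0)" "Gam 2 3 4 = (\<lambda>p. 0)" "Gam 2 4 3 = (\<lambda>p. 0)"
  "Gam 3 2 4 = (\<lambda>p. 0)" "Gam 3 4 2 = (\<lambda>p. 0)" "Gam 4 2 3 = (\<lambda>p. 0)" "Gam 4 3 2 = (\<lambda>p. 0)"
  by (auto simp: Gam_def)

lemma Gam_nonzero: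
  "Gam 1 3 3 = (\<lambda>p. p $ 2 / (f (xy p))^2)" "Gam 1 4 4 = (\<lambda>p. p $ 2 / (f (xy p))^2)"
  "Gam 2 3 3 = (\<lambda>p. 2 * a * p $ 2 / (f (xy p))^2)" "Gam 2 4 4 = (\<lambda>p. 2 * a * p $ 2 / (f (xy p))^2)"
  "Gam 3 2 3 = (\<lambda>p. 1 / p $ 2)" "Gam 3 3 2 = (\<lambda>p. 1 / p $ 2)"
  "Gam 4 2 4 = (\<lambda>p. 1 / p $ 2)" "Gam 4 4 2 = (\<lambda>p. 1 / p $ 2)"
  "Gam 3 4 4 = (\<lambda>p. dx f (xy p) / f (xy p))" "Gam 4 3 3 = (\<lambda>p. dy f (xy p) / f (xy p))"
  "Gam 3 3 3 = (\<lambda>p. - (dx f (xy p) / f (xy p)))" "Gam 4 4 4 = (\<lambda>p. - (dy f (xy p) / f (xy p)))"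
  "Gam 4 3 4 = (\<lambda>p. - (dx f (xy p) / f (xy p)))" "Gam 4 4 3 = (\<lambda>p. - (dx f (xy p) / f (xy p)))"
  "Gam 3 3 4 = (\<lambda>p. - (dy f (xy p) / f (xy p)))" "Gam 3 4 3 = (\<lambda>p. - (dy f (xy p) / f (xy p)))"
  by (simp_all add: Gam_def)

lemma christoffel_eq:
  assumes "p \<in> M"
  shows "christoffel g i j k p = Gam i j k p"
proof -
  have nz: "p $ 2 \<noteq> 0" "f (xy p) \<noteq> 0" using M assms f_nonzero by auto
  show ?thesis
    using exhaust_4[of i] exhaust_4[of j] exhaust_4[of k]
    by (elim disjE; simp add: christoffel_def sum_4 inverse_metric_nth[OF assms]
        pd_metric[OF assms] Gam_def nz; simp add: nz field_simps power_numeral_reduce)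
qed

section \<open>The curvature tensor and its Lie derivative\<close>

definition dx_wedge_dy :: "4 \<Rightarrow> 4 \<Rightarrow> real" where
  "dx_wedge_dy i j = (if i = 3 \<and> j = 4 then 1 else if i = 4 \<and> j = 3 then - 1 else 0)"

lemma dx_wedge_dy_antisym: "dx_wedge_dy i j = - dx_wedge_dy j i"
  by (simp add: dx_wedge_dy_def)

lemma pd_christoffel:
  assumes "p \<in> M"
  shows "pd l (christoffel g i j k) p = pd l (Gam i j k) p"
  using M(1) assms by (rule pd_cong) (rule christoffel_eq)

text \<open>The curvature tensor is \<open>r\<^sup>2 curv (dx \<and> dy) \<otimes> (dx \<and> dy)\<close>. Every component with an index \<open>t\<close>
  or \<open>r\<close> vanishes because the \<open>(t, r)\<close> plane is flat and \<open>r\<close> is an affine function on it: in a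
  warped product, the mixed components are multiples of the Hessian of the warping function.
  The proof evaluates the coordinate formula; antisymmetry in the last index pair leaves six
  pairs to compute.\<close>

lemma riemann_eq:
  assumes "p \<in> M"
  shows "riemann g i j k l p = dx_wedge_dy i j * dx_wedge_dy k l * ((p $ 2)^2 * curv (xy p))"
proof -
  have nz: "p $ 2 \<noteq> 0" "f (xy p) \<noteq> 0" using M assms f_nonzero by auto
  \<comment> \<open>Atomic names for the jet of \<open>f\<close> at the point; the identities become identities of rational
    functions in these variables.\<close>
  define r F X Y XX YX YY where [symmetric]: "r = p $ 2" "F = f (xy p)" "X = dx f (xy p)"
      "Y = dy f (xy p)" "XX = dx (dx f) (xy p)" "YX = dy (dx f) (xy p)" "YY = dy (dy f) (xy p)"
  note defs = this
  note d = differentiable_M[OF assms] differentiable_comp_xy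
    smooth_on_differentiable[OF smooth_on_pd[OF f_smooth] M(3)[OF assms]]
  have curv: "curv (xy p) = (X^2 + Y^2 - F * (XX + YY) - 2 * a) / F ^ 4"
    by (simp add: curv_def F1_def defs)
  have 1: "pd l (\<lambda>p. p $ 2 / (f (xy p))^2) p =
      (if l = 2 then 1 / F^2 else if l = 3 then - 2 * r * X / F^3
       else if l = 4 then - 2 * r * Y / F^3 else 0)" for l
    using exhaust_4[of l] nz
    by (elim disjE; simp add: pd_divide pd_power pd_component2 pd_comp_xy d;
        simp add: defs field_simps power_numeral_reduce)
  have 2: "pd l (\<lambda>p. 2 * a * p $ 2 / (f (xy p))^2) p =
      (if l = 2 then 2 * a / F^2 else if l = 3 then - 4 * a * r * X / F^3
       else if l = 4 then - 4 * a * r * Y / F^3 else 0)" for l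
    using exhaust_4[of l] nz
    by (elim disjE; simp add: pd_divide pd_mult pd_power pd_component2 pd_comp_xy d;
        simp add: defs field_simps power_numeral_reduce)
  have 3: "pd l (\<lambda>p. 1 / p $ 2) p = (if l = 2 then - 1 / r^2 else 0)" for l :: 4
    using nz d by (simp add: pd_divide pd_component2 defs power2_eq_square)
  have 4: "pd l (\<lambda>p. dx f (xy p) / f (xy p)) p =
      (if l = 3 then (XX * F - X * X) / (F * F) else if l = 4 then (YX * F - X * Y) / (F * F) else 0)" for l
    using exhaust_4[of l] nz
    by (elim disjE; simp add: pd_divide pd_comp_xy d; simp add: defs)
  have 5: "pd l (\<lambda>p. dy f (xy p) / f (xy p)) p =
      (if l = 3 then (YX * F - Y * X) / (F * F) else if l = 4 then (YY * F - Y * Y) / (F * F) else 0)" for l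
    using exhaust_4[of l] nz
    by (elim disjE; simp add: pd_divide pd_comp_xy d partials_commute M(3)[OF assms]; simp add: defs)
  have 6: "pd l (\<lambda>p. - (pd i f (xy p) / f (xy p))) p = - pd l (\<lambda>p. pd i f (xy p) / f (xy p)) p" for i l
    using nz d by (simp add: pd_uminus)
  have nz': "r \<noteq> 0" "F \<noteq> 0" using nz by (simp_all add: defs)
  note Gam_rules = pd_christoffel[OF assms] christoffel_eq[OF assms] Gam_zero Gam_nonzero
  let ?R = "\<lambda>i j k l. riemann g i j k l p = dx_wedge_dy i j * dx_wedge_dy k l * ((p $ 2)^2 * curv (xy p))"
  \<comment> \<open>With \<open>t\<close> in the last pair, all terms of the sum vanish separately.\<close>
  have *: "?R i j 1 2" "?R i j 1 3" "?R i j 1 4"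
    using exhaust_4[of i] exhaust_4[of j]
    by (elim disjE; simp add: riemann_def sum_4 metric_nth Gam_rules dx_wedge_dy_def 1 2 3 4 5 6)+
  have **: "?R i j 2 3" "?R i j 2 4"
    using exhaust_4[of i] exhaust_4[of j]
    by (elim disjE; simp add: riemann_def sum_4 metric_nth Gam_rules dx_wedge_dy_def 1 2 3 4 5 6 curv;
        simp add: defs nz'; simp add: nz' field_simps power_numeral_reduce)+
  have ***: "?R i j 3 4"
    using exhaust_4[of i] exhaust_4[of j]
    by (elim disjE; simp add: riemann_def sum_4 metric_nth Gam_rules dx_wedge_dy_def 1 2 3 4 5 6 curv;
        simp add: defs nz'; simp add: nz' field_simps power_numeral_reduce)
  have swap: "?R i j l k" if "?R i j k l" for k l
    using that riemann_antisym[of g i j l k p] dx_wedge_dy_antisym[of l k] by simp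
  have same: "?R i j k k" for k
    using riemann_antisym[of g i j k k p] dx_wedge_dy_antisym[of k k] by simp
  show ?thesis
    using exhaust_4[of k] exhaust_4[of l] by (elim disjE; simp only: * ** *** swap same)
qed

text \<open>The vector field has constant components and the forms \<open>dx\<close>, \<open>dy\<close> have constant coefficients,
  so the Lie derivative of the curvature only differentiates the scalar \<open>r\<^sup>2 curv\<close> in \<open>x\<close>, and
  \<open>r\<close> is constant in that direction.\<close>

theorem inheritance: "curvature_inheritance M g (\<lambda>_. axis 3 1) (\<lambda>p. RT_factor a f (xy p))"
  unfolding curvature_inheritance_def
proof (intro conjI ballI allI)
  show "smooth_on M (\<lambda>p. RT_factor a f (xy p))"
    using smooth_RT_factor M(3) by (intro smooth_on_comp_xy) auto
  fix p i j k l assume p: "p \<in> M"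
  have "smooth_on \<Omega> curv"
    unfolding curv_def[abs_def]
    by (intro smooth_on_intros \<Omega> f_smooth smooth_F1) (simp add: f_nonzero)
  then have d: "(\<lambda>p. curv (xy p)) differentiable (at p)"
    by (intro differentiable_comp_xy diff_Omega M p)
  have "pd 3 (riemann g i j k l) p =
      pd 3 (\<lambda>p. dx_wedge_dy i j * dx_wedge_dy k l * ((p $ 2)^2 * curv (xy p))) p"
    using M(1) p by (rule pd_cong) (rule riemann_eq)
  also have "\<dots> = dx_wedge_dy i j * dx_wedge_dy k l * ((p $ 2)^2 * dx curv (xy p))"
    by (simp add: pd_mult pd_power pd_component2 pd_comp_xy d differentiable_M p)
  also have "\<dots> = RT_factor a f (xy p) * riemann g i j k l p"
    by (simp add: dx_curv M p riemann_eq)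
  finally show "lie_derivative (\<lambda>_. axis 3 1) (riemann g) i j k l p
      = RT_factor a f (xy p) * riemann g i j k l p"
    by (simp add: lie_derivative_axis)
qed

end

theorem corollary4p3:
  fixes a b d :: real and I J :: "real set" and \<Omega> :: "(real^2) set" and f :: "real^2 \<Rightarrow> real"
  assumes "open I" "is_interval I" "I \<noteq> {}"
    and "open J" "is_interval J" "J \<noteq> {}" "0 \<notin> J"
    and "open \<Omega>" "connected \<Omega>" "\<Omega> \<noteq> {}"
    and "smooth_on \<Omega> f" "\<forall>z\<in>\<Omega>. f z \<noteq> 0"
    and "b = 0" "d = 0"
    and "\<forall>p\<in>RT_domain I J \<Omega>. F1 f (xy p) - 2 * a \<noteq> 0"
    and "\<forall>p\<in>RT_domain I J \<Omega>. p $ 2 * F1 f (xy p) - 2 * a * p $ 2 \<noteq> 0"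
  shows "curvature_inheritance (RT_domain I J \<Omega>) (RT_metric a b d f)
           (\<lambda>p. axis 3 1) (\<lambda>p. RT_factor a f (xy p))"
proof -
  interpret RT_cone a I J \<Omega> f
    by unfold_locales (use assms in auto)
  show ?thesis
    using inheritance \<open>b = 0\<close> \<open>d = 0\<close> by simp
qed

end
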